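(* For every positive integer $r$, \[ \sum_{n=0}^\infty \frac{2}{(n+1)(2n+2r+1)}\frac{\binom{2n}{n}}{\binom{2n+2r}{n+r}}=\frac{1}{(2r-1)\binom{2r-2}{r-1}}-\frac{1}{2^{2r-1}r}. \] *)

theory Defs
  imports Complex_Main
begin

end

theory Submission
  imports Defs
begin

text \<open>
  Write \<open>c n\<close> for the central binomial coefficient and \<open>S r\<close> for the sum. Termwise,
  \<open>S (r + 1) - r / (2 (2 r + 1)) S r\<close> is a telescoping series, with the antidifference
  \<open>n / ((2 r + 1) (r + 1) (2 n + 2 r + 1)) * c n / c (n + r)\<close> found by Gosper's method.
  Its limit comes from \<open>c n / c (n + r) \<longlonglongrightarrow> 1 / 4 ^ r\<close>, and the
  claimed closed form solves the resulting first-order recurrence in \<open>r\<close>.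
\<close>

definition central_binomial :: "nat \<Rightarrow> real" where
  "central_binomial n = real ((2 * n) choose n)"

lemma central_binomial_pos: "central_binomial n > 0"
  by (simp add: central_binomial_def)

lemma central_binomial_0: "central_binomial 0 = 1"
  by (simp add: central_binomial_def)

lemma central_binomial_Suc:
  "central_binomial (Suc n) = 2 * (2 * real n + 1) / (real n + 1) * central_binomial n"
proof -
  have fact_form: "central_binomial m = fact (2 * m) / (fact m * fact m)" for m
    unfolding central_binomial_def by (subst binomial_fact) (auto simp: mult_2)
  have "real n + 1 > 0" by simp
  then show ?thesis
    unfolding fact_form by (simp add: divide_simps) (simp add: algebra_simps)
qed

text \<open>Shifting \<open>n\<close> or \<open>r\<close> by one multiplies
  \<open>central_binomial n / central_binomial (n + r)\<close> by a rational function. This rule and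
  the next one let all shifted terms be written over one common ratio.\<close>

lemma central_binomial_ratio_Suc:
  "central_binomial (Suc n) / central_binomial (Suc n + r) =
     (2 * real n + 1) * (real n + real r + 1) / ((real n + 1) * (2 * real n + 2 * real r + 1))
       * (central_binomial n / central_binomial (n + r))"
  using central_binomial_pos[of "n + r"]
  by (simp add: central_binomial_Suc divide_simps) (simp add: algebra_simps)

lemma central_binomial_ratio_Suc_shift:
  "central_binomial n / central_binomial (n + Suc r) =
     (real n + real r + 1) / (2 * (2 * real n + 2 * real r + 1))
       * (central_binomial n / central_binomial (n + r))"
  using central_binomial_pos[of "n + r"]
  by (simp add: central_binomial_Suc divide_simps)

lemma linear_ratio_tendsto:
  fixes a b c d :: real
  assumes "c \<noteq> 0"
  shows "(\<lambda>n. (a * real n + b) / (c * real n + d)) \<longlonglongrightarrow> a / c"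
proof -
  have "(\<lambda>n. (a + b / real n) / (c + d / real n)) \<longlonglongrightarrow> (a + 0) / (c + 0)"
    using assms by (intro tendsto_intros lim_const_over_n) auto
  \<comment> \<open>Numerator and denominator are divided by \<open>n\<close>, which is legitimate
    only for \<open>n > 0\<close>; hence an eventual equality.\<close>
  moreover have "\<forall>\<^sub>F n in sequentially.
      (a + b / real n) / (c + d / real n) = (a * real n + b) / (c * real n + d)"
    using eventually_gt_at_top[of 0]
  proof eventually_elim
    case (elim n)
    then have "a + b / real n = (a * real n + b) / real n" "c + d / real n = (c * real n + d) / real n"
      by (simp_all add: add_divide_distrib)
    with elim show ?case by simp
  qed
  ultimately show ?thesis
    by (simp add: Lim_transform_eventually)
qed

text \<open>Raising \<open>r\<close> by one contributes a factor that tends to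
  \<open>1 / 4\<close>.\<close>

lemma central_binomial_ratio_tendsto:
  "(\<lambda>n. central_binomial n / central_binomial (n + r)) \<longlonglongrightarrow> 1 / 4 ^ r"
proof (induction r)
  case 0
  show ?case
    using central_binomial_pos by (simp add: less_imp_neq[symmetric])
next
  case (Suc r)
  have "(\<lambda>n. (real n + real r + 1) / (2 * (2 * real n + 2 * real r + 1))) \<longlonglongrightarrow> 1 / 4"
    using linear_ratio_tendsto[of 4 1 "real r + 1" "4 * real r + 2"] by (simp add: algebra_simps)
  from tendsto_mult[OF this Suc.IH] show ?case
    by (simp only: central_binomial_ratio_Suc_shift) simp
qed

definition summand :: "nat \<Rightarrow> nat \<Rightarrow> real" where
  "summand r n = 2 / ((real n + 1) * (2 * real n + 2 * real r + 1))
     * (central_binomial n / central_binomial (n + r))"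

definition antidifference :: "nat \<Rightarrow> nat \<Rightarrow> real" where
  "antidifference r n =
     real n / ((2 * real r + 1) * (real r + 1) * (2 * real n + 2 * real r + 1))
       * (central_binomial n / central_binomial (n + r))"

lemma antidifference_diff:
  "antidifference r (Suc n) - antidifference r n =
     summand (Suc r) n - real r / (2 * (2 * real r + 1)) * summand r n"
proof -
  define u where "u = central_binomial n / central_binomial (n + r)"
  have pos: "real n + 1 > 0" "2 * real n + 2 * real r + 1 > 0" "2 * real n + 2 * real r + 3 > 0"
    "2 * real r + 1 > 0" "real r + 1 > 0"
    by simp_all
  \<comment> \<open>Both sides reduce to this common value: the numerator collapses to
    \<open>r + 1\<close> on the left and to \<open>n + 1\<close> on the right, and each
    cancels.\<close>
  have "antidifference r (Suc n) - antidifference r n =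
      u / ((2 * real r + 1) * (2 * real n + 2 * real r + 1) * (2 * real n + 2 * real r + 3))"
  proof -
    have Suc_n: "antidifference r (Suc n) =
      (real n + 1) / ((2 * real r + 1) * (real r + 1) * (2 * real n + 2 * real r + 3)) *
      ((2 * real n + 1) * (real n + real r + 1) / ((real n + 1) * (2 * real n + 2 * real r + 1)) * u)"
      unfolding antidifference_def central_binomial_ratio_Suc u_def by (simp add: algebra_simps)
    have n: "antidifference r n =
      real n / ((2 * real r + 1) * (real r + 1) * (2 * real n + 2 * real r + 1)) * u"
      by (simp add: antidifference_def u_def)
    show ?thesis
      unfolding Suc_n n using pos by (simp add: divide_simps del: distrib_left_numeral) algebra
  qed
  also have "\<dots> = summand (Suc r) n - real r / (2 * (2 * real r + 1)) * summand r n"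
  proof -
    have Suc_r: "summand (Suc r) n = 2 / ((real n + 1) * (2 * real n + 2 * real r + 3)) *
        ((real n + real r + 1) / (2 * (2 * real n + 2 * real r + 1)) * u)"
      unfolding summand_def central_binomial_ratio_Suc_shift u_def by (simp add: algebra_simps)
    have r: "summand r n = 2 / ((real n + 1) * (2 * real n + 2 * real r + 1)) * u"
      by (simp add: summand_def u_def)
    show ?thesis
      unfolding Suc_r r using pos by (simp add: divide_simps del: distrib_left_numeral) algebra
  qed
  finally show ?thesis .
qed

lemma antidifference_tendsto:
  "antidifference r \<longlonglongrightarrow> 1 / (2 * (2 * real r + 1) * (real r + 1) * 4 ^ r)"
proof -
  define k where "k = (2 * real r + 1) * (real r + 1)"
  have "k > 0" by (simp add: k_def)
  then have "(\<lambda>n. real n / (k * (2 * real n + 2 * real r + 1))) \<longlonglongrightarrow> 1 / (2 * k)"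
    using linear_ratio_tendsto[of "2 * k" 1 0 "k * (2 * real r + 1)"] by (simp add: algebra_simps)
  from tendsto_mult[OF this central_binomial_ratio_tendsto[of r]] show ?thesis
    unfolding antidifference_def k_def by (simp add: mult.assoc del: distrib_left_numeral)
qed

lemma sums_summand_Suc:
  "summand (Suc s) sums
     (1 / ((2 * real s + 1) * central_binomial s) - 1 / (2 * 4 ^ s * (real s + 1)))"
proof (induction s)
  case 0
  \<comment> \<open>This is \<open>antidifference 0 n = n / (2 * n + 1)\<close> lowered by its limit
    \<open>1 / 2\<close>, so that it tends to 0.\<close>
  have "(\<lambda>n. - 1 / (2 * (2 * real n + 1))) \<longlonglongrightarrow> 0"
    using linear_ratio_tendsto[of 4 0 "-1" 2] by (simp add: algebra_simps)
  from telescope_sums[OF this]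
  have "(\<lambda>n. - 1 / (2 * (2 * real (Suc n) + 1)) - - 1 / (2 * (2 * real n + 1))) sums (1 / 2)"
    by simp
  moreover have "- 1 / (2 * (2 * real (Suc n) + 1)) - - 1 / (2 * (2 * real n + 1))
      = summand (Suc 0) n" for n
  proof -
    have "real n + 1 > 0" "2 * real n + 1 > 0" "2 * real n + 3 > 0" by simp_all
    with central_binomial_pos[of n] show ?thesis
      by (simp add: summand_def central_binomial_Suc divide_simps) (simp add: algebra_simps)
  qed
  ultimately show ?case
    by (simp add: central_binomial_0)
next
  case (Suc s)
  define r where "r = Suc s"
  \<comment> \<open>Since \<open>antidifference r 0 = 0\<close>, the telescoped sum is just the
    limit.\<close>
  have "(\<lambda>n. antidifference r (Suc n) - antidifference r n) sums
      (1 / (2 * (2 * real r + 1) * (real r + 1) * 4 ^ r))"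
    using telescope_sums[OF antidifference_tendsto[of r]] by (simp add: antidifference_def)
  \<comment> \<open>Adding this multiple of the induction hypothesis cancels the subtracted term in
    \<open>antidifference_diff\<close>.\<close>
  from sums_add[OF this sums_mult[OF Suc.IH, of "real r / (2 * (2 * real r + 1))"]]
  have "summand (Suc r) sums (1 / (2 * (2 * real r + 1) * (real r + 1) * 4 ^ r) +
      real r / (2 * (2 * real r + 1)) *
        (1 / ((2 * real s + 1) * central_binomial s) - 1 / (2 * 4 ^ s * (real s + 1))))"
    by (simp add: antidifference_diff flip: r_def)
  \<comment> \<open>The binomial terms agree by the recurrence for \<open>central_binomial\<close>;
    the powers of 4 combine through \<open>1 - 2 * (r + 1) = - (2 * r + 1)\<close>.\<close>
  also have "\<dots> = 1 / ((2 * real r + 1) * central_binomial r) - 1 / (2 * 4 ^ r * (real r + 1))"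
  proof -
    have "2 * real s + 1 > 0" "2 * real s + 3 > 0" "real s + 1 > 0" "real s + 2 > 0"
      by simp_all
    with central_binomial_pos[of s] show ?thesis
      by (simp add: r_def central_binomial_Suc divide_simps) algebra
  qed
  finally show ?case by (simp add: r_def)
qed

theorem theorem9:
  fixes r :: nat
  assumes "r > 0"
  shows "(\<lambda>n::nat. 2 / ((real n + 1) * (2 * real n + 2 * real r + 1))
              * (real ((2 * n) choose n) / real ((2 * n + 2 * r) choose (n + r))))
         sums (1 / ((2 * real r - 1) * real ((2 * r - 2) choose (r - 1)))
               - 1 / (2 ^ (2 * r - 1) * real r))"
proof -
  \<comment> \<open>Passing to the predecessor removes the truncated subtractions on
    \<open>nat\<close> from the closed form.\<close>
  from assms obtain s where s: "r = Suc s"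
    using gr0_implies_Suc by blast
  have "2 ^ (2 * r - 1) = (2 * 4 ^ s :: real)"
    by (simp add: s power_mult)
  moreover have "2 * r - 2 = 2 * s" "r - 1 = s" "2 * real r - 1 = 2 * real s + 1"
    "real r = real s + 1"
    by (simp_all add: s)
  moreover have "2 * n + 2 * r = 2 * (n + r)" for n
    by simp
  ultimately show ?thesis
    using sums_summand_Suc[of s, folded s]
    unfolding summand_def central_binomial_def by (simp only:)
qed

end
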